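(* Let $G$ and $H$ be two strongly connected digraphs, each of order at least $2$. Then $$\lambda(G\Box H)=\min\{\lambda(G)\,|V(H)|,\ \lambda(H)\,|V(G)|,\ \delta^+(G)+\delta^+(H),\ \delta^-(G)+\delta^-(H)\}.$$
   Context: All digraphs are finite, without loops or parallel arcs. For a digraph $D$, $\lambda(D)$ denotes its arc-strong connectivity (the minimum number of arcs whose removal leaves a digraph that is not strongly connected), and $\delta^+(D)$, $\delta^-(D)$ denote the minimum out-degree and minimum in-degree of $D$. The Cartesian product $G\Box H$ of digraphs $G$ and $H$ has vertex set $V(G)\times V(H)$, and $(x,x')(y,y')$ is an arc iff either $xy\in A(G)$ and $x'=y'$, or $x=y$ and $x'y'\in A(H)$. *)

theory Defs
  imports "Graph_Theory.Graph_Theory"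
begin

text \<open>
  Finite digraphs without loops or parallel arcs are instances of \<^locale>\<open>pair_digraph\<close>:
  arcs are ordered pairs of vertices, so parallel arcs cannot occur.
\<close>

definition delete_arcs :: "'a pair_pre_digraph \<Rightarrow> ('a \<times> 'a) set \<Rightarrow> 'a pair_pre_digraph" where
  "delete_arcs D S = D\<lparr>parcs := parcs D - S\<rparr>"

text \<open>
  If \<open>D\<close> has only one vertex, no set of arcs is disconnecting and the minimum is taken over the
  empty set. For finite \<open>D\<close> with at least two vertices the set is finite and nonempty, see below.
\<close>
definition arc_strong_connectivity :: "'a pair_pre_digraph \<Rightarrow> nat" where
  "arc_strong_connectivity D =
    Min {card S | S. S \<subseteq> parcs D \<and> \<not> strongly_connected (delete_arcs D S)}"

definition min_out_degree :: "'a pair_pre_digraph \<Rightarrow> nat" where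
  "min_out_degree D = Min (out_degree D ` pverts D)"

definition min_in_degree :: "'a pair_pre_digraph \<Rightarrow> nat" where
  "min_in_degree D = Min (in_degree D ` pverts D)"

definition cartesian_product ::
  "'a pair_pre_digraph \<Rightarrow> 'b pair_pre_digraph \<Rightarrow> ('a \<times> 'b) pair_pre_digraph" (infixl "\<box>" 70) where
  "G \<box> H =
    \<lparr> pverts = pverts G \<times> pverts H,
      parcs = {((x, x'), (y, y')) | x x' y y'.
        x \<in> pverts G \<and> y \<in> pverts G \<and> x' \<in> pverts H \<and> y' \<in> pverts H \<and>
        ((x, y) \<in> parcs G \<and> x' = y' \<or> x = y \<and> (x', y') \<in> parcs H)} \<rparr>"

lemma pair_digraph_cartesian_product:
  assumes "pair_digraph G" "pair_digraph H"
  shows "pair_digraph (G \<box> H)"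
proof -
  interpret G: pair_digraph G by fact
  interpret H: pair_digraph H by fact
  have sub: "parcs (G \<box> H) \<subseteq> (pverts G \<times> pverts H) \<times> (pverts G \<times> pverts H)"
    by (auto simp: cartesian_product_def)
  show ?thesis
  proof
    show "finite (parcs (G \<box> H))"
      using sub by (rule finite_subset) simp
  qed (auto simp: cartesian_product_def dest: G.no_loops H.no_loops)
qed

lemma disconnecting_arc_sets:
  assumes "pair_digraph D" "2 \<le> card (pverts D)"
  defines "C \<equiv> {card S | S. S \<subseteq> parcs D \<and> \<not> strongly_connected (delete_arcs D S)}"
  shows "finite C" "C \<noteq> {}"
proof -
  interpret pair_digraph D by fact
  have "C \<subseteq> card ` Pow (parcs D)" by (auto simp: C_def)
  then show "finite C" by (rule finite_subset) simp
  obtain u v where uv: "u \<in> pverts D" "v \<in> pverts D" "u \<noteq> v"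
    using assms(2) card_le_Suc0_iff_eq[OF pair_finite_verts] by fastforce
  have "\<not> strongly_connected (delete_arcs D (parcs D))"
  proof
    assume "strongly_connected (delete_arcs D (parcs D))"
    then have "u \<rightarrow>\<^sup>*\<^bsub>delete_arcs D (parcs D)\<^esub> v"
      using uv by (auto simp: strongly_connected_def delete_arcs_def)
    then have "(u, v) \<in> (arcs_ends (delete_arcs D (parcs D)))\<^sup>*"
      by (rule reachable_rtranclI)
    then show False
      using uv by (simp add: delete_arcs_def arcs_ends_def)
  qed
  then have "card (parcs D) \<in> C" by (auto simp: C_def)
  then show "C \<noteq> {}" by blast
qed

end

theory Submission
  imports Defs
begin

text \<open>
  The arc-strong connectivity is the least number of arcs leaving a nonempty proper vertex set \<open>X\<close>.
  In a product, these arcs are those leaving the rows of \<open>X\<close> in copies of \<open>G\<close> together with those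
  leaving the columns of \<open>X\<close> in copies of \<open>H\<close>. If all rows, or all columns, are neither empty nor
  full, the bound \<open>\<lambda>(G)|V(H)|\<close>, or \<open>\<lambda>(H)|V(G)|\<close>, follows. Otherwise, up to complement and arc reversal,
  some row and some column are empty, so every nonempty row and column emits at least one arc.
  A nonempty row with at most \<open>\<delta>\<^sup>+(G)\<close> elements emits at least \<open>\<delta>\<^sup>+(G)\<close> arcs, while a larger row
  forces more than \<open>\<delta>\<^sup>+(G)\<close> nonempty columns; the same holds with rows and columns exchanged.
  Either way \<open>\<delta>\<^sup>+(G) + \<delta>\<^sup>+(H)\<close> arcs are found.
\<close>

section \<open>Arcs leaving a vertex set, for bare relations\<close>

text \<open>Stated for a bare relation, so that it applies equally to the arcs of either factor and
  to their reversals. The complement is taken in the whole type; for \<open>R\<close> inside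
  \<open>V \<times> V\<close> this agrees with the complement in \<open>V\<close>.\<close>

definition out_cut :: "('a \<times> 'a) set \<Rightarrow> 'a set \<Rightarrow> ('a \<times> 'a) set" where
  "out_cut R A = R \<inter> A \<times> (- A)"

lemma finite_out_cut [simp]: "finite R \<Longrightarrow> finite (out_cut R A)"
  by (simp add: out_cut_def)

lemma out_cut_empty [simp]: "out_cut R {} = {}"
  by (simp add: out_cut_def)

lemma out_cut_full: "R \<subseteq> V \<times> V \<Longrightarrow> out_cut R V = {}"
  by (auto simp: out_cut_def)

lemma card_out_cut_singleton:
  assumes "\<And>x. (x, x) \<notin> R"
  shows "card (out_cut R {x}) = card (R `` {x})"
proof -
  have "out_cut R {x} = {x} \<times> R `` {x}"
    using assms by (auto simp: out_cut_def)
  then show ?thesis by (simp add: card_cartesian_product)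
qed

text \<open>This is the duality behind the in-degree half: passing to the complement and reversing
  all arcs keeps cut sizes and swaps out-degrees with in-degrees.\<close>

lemma card_out_cut_converse:
  assumes "R \<subseteq> V \<times> V" "A \<subseteq> V"
  shows "card (out_cut (R\<inverse>) (V - A)) = card (out_cut R A)"
proof -
  have "out_cut (R\<inverse>) (V - A) = (out_cut R A)\<inverse>"
    using assms by (auto simp: out_cut_def)
  then show ?thesis by simp
qed

text \<open>Without loops, a vertex of a \<open>k\<close>-element set has at most
  \<open>k - 1\<close> out-neighbours inside it, hence at least \<open>d + 1 - k\<close> outside.
  Summing over the set gives \<open>k * (d + 1 - k)\<close>, which is at least \<open>d\<close> for
  1 \<le> k \<le> d.\<close>

lemma degree_le_card_out_cut:
  fixes d :: nat
  assumes "finite R" "\<And>x. (x, x) \<notin> R" "finite A" "A \<noteq> {}" "card A \<le> d"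
    and deg: "\<And>x. x \<in> A \<Longrightarrow> d \<le> card (R `` {x})"
  shows "d \<le> card (out_cut R A)"
proof -
  define k where "k = card A"
  have k: "1 \<le> k" "k \<le> d"
    using assms by (auto simp: k_def Suc_le_eq card_gt_0_iff)
  have fin: "finite (R `` {x})" for x
    using assms(1) by (simp add: finite_Image)
  have step: "d + 1 - k \<le> card (R `` {x} - A)" if "x \<in> A" for x
  proof -
    \<comment> \<open>Looplessness lets \<open>x\<close> be dropped from \<open>A\<close>, which
      gains the one over the crude bound \<open>d - k\<close>.\<close>
    have "R `` {x} - A = R `` {x} - (A - {x})"
      using assms(2) by auto
    moreover have "card (R `` {x}) - card (A - {x}) \<le> card (R `` {x} - (A - {x}))"
      using assms(3) by (intro diff_card_le_card_Diff) simp
    moreover have "card (A - {x}) = k - 1"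
      using that by (simp add: k_def)
    ultimately show ?thesis
      using deg[OF that] k by simp
  qed
  have "out_cut R A = Sigma A (\<lambda>x. R `` {x} - A)"
    by (auto simp: out_cut_def)
  then have "card (out_cut R A) = (\<Sum>x\<in>A. card (R `` {x} - A))"
    using assms(3) fin by simp
  moreover have "(\<Sum>x\<in>A. d + 1 - k) \<le> (\<Sum>x\<in>A. card (R `` {x} - A))"
    by (rule sum_mono) (rule step)
  moreover have "d \<le> k * (d + 1 - k)"
  proof -
    \<comment> \<open>With \<open>k = i + 1\<close> and \<open>d = k + j\<close>, the product is
      \<open>(i + 1) * (j + 1) = i * j + d\<close>.\<close>
    obtain i where "k = Suc i" using k by (cases k) auto
    moreover obtain j where "d = k + j" using k le_Suc_ex by blast
    ultimately show ?thesis by simp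
  qed
  ultimately show ?thesis by (simp add: k_def)
qed

section \<open>Lower bound for cuts of a product, by rows and columns\<close>

text \<open>The row at \<open>y\<close> is the set of \<open>x\<close> with \<open>(x, y)\<close> in
  \<open>X\<close>; \<open>Range X\<close> indexes the nonempty rows and \<open>Domain X\<close> the
  nonempty columns. Every nonempty row is proper and pays at least 1. A nonempty row of size at most
  \<open>d\<close> pays \<open>d\<close> in place of its 1, whence the \<open>+ 1\<close>; if there
  is none, a single row already meets more than \<open>d\<close> columns. Only one direction is
  treated, so that the converse of \<open>X\<close> yields the bounds for columns.\<close>

lemma slice_cut_bounds:
  fixes X :: "('a \<times> 'b) set" and d :: nat
  assumes fin: "finite V" "finite W" and X: "X \<subseteq> V \<times> W" "X \<noteq> {}"
    and R: "R \<subseteq> V \<times> V" "\<And>x. (x, x) \<notin> R"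
    and deg: "\<And>x. x \<in> V \<Longrightarrow> d \<le> card (R `` {x})"
    and cut: "\<And>A. A \<noteq> {} \<Longrightarrow> A \<subset> V \<Longrightarrow> 1 \<le> card (out_cut R A)"
    and proper: "\<And>y. X\<inverse> `` {y} \<noteq> V"
  defines "S \<equiv> \<Sum>y\<in>W. card (out_cut R (X\<inverse> `` {y}))"
  shows "card (Range X) \<le> S"
    and "d + card (Range X) \<le> S + 1 \<or> d < card (Domain X)"
proof -
  have finR: "finite R" using R(1) fin(1) by (meson finite_SigmaI finite_subset)
  have RW: "Range X \<subseteq> W" and DV: "Domain X \<subseteq> V" using X(1) by auto
  have finRX: "finite (Range X)" "finite (Domain X)"
    using RW DV fin finite_subset by blast+
  have slice: "X\<inverse> `` {y} \<noteq> {}" "X\<inverse> `` {y} \<subset> V" if "y \<in> Range X" for y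
  proof -
    show "X\<inverse> `` {y} \<noteq> {}" using that by blast
    have "X\<inverse> `` {y} \<subseteq> V" using X(1) by blast
    then show "X\<inverse> `` {y} \<subset> V" using proper by (rule psubsetI)
  qed
  have one: "1 \<le> card (out_cut R (X\<inverse> `` {y}))" if "y \<in> Range X" for y
    by (rule cut) (rule slice[OF that])+
  have S: "(\<Sum>y\<in>Range X. card (out_cut R (X\<inverse> `` {y}))) \<le> S"
    unfolding S_def by (rule sum_mono2) (use fin RW in auto)
  have "(\<Sum>y\<in>Range X. 1) \<le> (\<Sum>y\<in>Range X. card (out_cut R (X\<inverse> `` {y})))"
    by (rule sum_mono) (rule one)
  then show "card (Range X) \<le> S" using S by simp
  show "d + card (Range X) \<le> S + 1 \<or> d < card (Domain X)"
  proof (cases "\<exists>y\<in>Range X. card (X\<inverse> `` {y}) \<le> d")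
    case True
    \<comment> \<open>The small row \<open>y\<close> is split off from the sum: it pays
      \<open>d\<close>, and each other nonempty row at least 1.\<close>
    then obtain y where y: "y \<in> Range X" "card (X\<inverse> `` {y}) \<le> d" by blast
    have "d \<le> card (out_cut R (X\<inverse> `` {y}))"
    proof (rule degree_le_card_out_cut[OF finR R(2)])
      show "finite (X\<inverse> `` {y})" using slice(2)[OF y(1)] fin(1) finite_subset by blast
    qed (use slice[OF y(1)] y deg in auto)
    moreover have "(\<Sum>z\<in>Range X - {y}. 1) \<le> (\<Sum>z\<in>Range X - {y}. card (out_cut R (X\<inverse> `` {z})))"
      by (rule sum_mono) (rule one, simp)
    moreover have "(\<Sum>z\<in>Range X. card (out_cut R (X\<inverse> `` {z})))
        = card (out_cut R (X\<inverse> `` {y})) + (\<Sum>z\<in>Range X - {y}. card (out_cut R (X\<inverse> `` {z})))"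
      using finRX y(1) by (simp add: sum.remove)
    moreover have "card (Range X) = Suc (card (Range X - {y}))"
      using finRX y(1) by (metis card.remove)
    ultimately show ?thesis using S by simp
  next
    case False
    obtain x y where "(x, y) \<in> X" using X(2) by auto
    then have "d < card (X\<inverse> `` {y})" using False by (meson RangeI linorder_not_le)
    also have "\<dots> \<le> card (Domain X)"
      by (rule card_mono) (use finRX in auto)
    finally show ?thesis ..
  qed
qed

text \<open>The empty row and the empty column prevent any column or row from being full, so the
  slice bounds apply in both directions and only have to be combined.\<close>

lemma sparse_set_cut_bound:
  fixes X :: "('a \<times> 'b) set"
  assumes fin: "finite V" "finite W" and X: "X \<subseteq> V \<times> W" "X \<noteq> {}"
    and R: "R \<subseteq> V \<times> V" "\<And>x. (x, x) \<notin> R"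
    and T: "T \<subseteq> W \<times> W" "\<And>y. (y, y) \<notin> T"
    and deg: "\<And>x. x \<in> V \<Longrightarrow> d \<le> card (R `` {x})" "\<And>y. y \<in> W \<Longrightarrow> f \<le> card (T `` {y})"
    and cut: "\<And>A. A \<noteq> {} \<Longrightarrow> A \<subset> V \<Longrightarrow> 1 \<le> card (out_cut R A)"
      "\<And>B. B \<noteq> {} \<Longrightarrow> B \<subset> W \<Longrightarrow> 1 \<le> card (out_cut T B)"
    and empty: "x\<^sub>0 \<in> V" "X `` {x\<^sub>0} = {}" "y\<^sub>0 \<in> W" "X\<inverse> `` {y\<^sub>0} = {}"
  shows "d + f \<le> (\<Sum>y\<in>W. card (out_cut R (X\<inverse> `` {y}))) + (\<Sum>x\<in>V. card (out_cut T (X `` {x})))"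
proof -
  \<comment> \<open>Every row misses \<open>x\<^sub>0\<close> and every column misses
    \<open>y\<^sub>0\<close>.\<close>
  have 1: "X\<inverse> `` {y} \<noteq> V" for y using empty(1,2) by blast
  have 2: "(X\<inverse>)\<inverse> `` {x} \<noteq> W" for x using empty(3,4) by blast
  have X': "X\<inverse> \<subseteq> W \<times> V" "X\<inverse> \<noteq> {}" using X by auto
  have fins: "finite (Domain X)" "finite (Range X)"
    using X(1) fin by (meson finite_SigmaI finite_subset finite_Domain finite_Range)+
  have pos: "0 < card (Domain X)" "0 < card (Range X)"
    using X(2) fins by (auto simp: card_gt_0_iff)
  note rows = slice_cut_bounds[OF fin X R deg(1) cut(1) 1]
  note cols = slice_cut_bounds[OF fin(2,1) X' T deg(2) cut(2) 2, simplified]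
  \<comment> \<open>Let \<open>r\<close>, \<open>c\<close> be the numbers of nonempty rows and
    columns. With a small row and a small column, the two sums total at least
    \<open>d + r - 1 + f + c - 1\<close>, and \<open>r\<close>, \<open>c\<close> are positive. With
    a small row and \<open>f < r\<close>, the row sum alone is at least \<open>d + r - 1\<close>,
    hence at least \<open>d + f\<close>; the mirror case is alike. If \<open>d < c\<close> and
    \<open>f < r\<close>, the trivial bounds \<open>c\<close> and \<open>r\<close> suffice.\<close>
  show ?thesis using rows cols pos by auto
qed

text \<open>If every row is neither empty nor full, each pays \<open>a\<close>; likewise each column
  pays \<open>b\<close>. Otherwise some row and some column are uniform, and since they cross they
  are both empty or both full. The first case is the sparse bound with out-degrees, the second the
  same bound for the reversed arcs and the complement of \<open>X\<close>, with in-degrees.\<close>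

lemma product_cut_lower_bound:
  fixes X :: "('a \<times> 'b) set"
  assumes fin: "finite V" "finite W" and X: "X \<noteq> {}" "X \<subset> V \<times> W"
    and R: "R \<subseteq> V \<times> V" "\<And>x. (x, x) \<notin> R"
    and T: "T \<subseteq> W \<times> W" "\<And>y. (y, y) \<notin> T"
    and out: "\<And>x. x \<in> V \<Longrightarrow> d \<le> card (R `` {x})" "\<And>y. y \<in> W \<Longrightarrow> f \<le> card (T `` {y})"
    and inn: "\<And>x. x \<in> V \<Longrightarrow> d' \<le> card (R\<inverse> `` {x})" "\<And>y. y \<in> W \<Longrightarrow> f' \<le> card (T\<inverse> `` {y})"
    and cut: "\<And>A. A \<noteq> {} \<Longrightarrow> A \<subset> V \<Longrightarrow> a \<le> card (out_cut R A)"
      "\<And>B. B \<noteq> {} \<Longrightarrow> B \<subset> W \<Longrightarrow> b \<le> card (out_cut T B)"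
    and pos: "1 \<le> a" "1 \<le> b"
  defines "S \<equiv> (\<Sum>y\<in>W. card (out_cut R (X\<inverse> `` {y}))) + (\<Sum>x\<in>V. card (out_cut T (X `` {x})))"
  shows "a * card W \<le> S \<or> b * card V \<le> S \<or> d + f \<le> S \<or> d' + f' \<le> S"
proof -
  have rowV: "X\<inverse> `` {y} \<subseteq> V" and colW: "X `` {x} \<subseteq> W" for x y using X(2) by auto
  consider (rows) "\<And>y. y \<in> W \<Longrightarrow> X\<inverse> `` {y} \<noteq> {} \<and> X\<inverse> `` {y} \<noteq> V"
    | (cols) "\<And>x. x \<in> V \<Longrightarrow> X `` {x} \<noteq> {} \<and> X `` {x} \<noteq> W"
    | (uniform) x y where "x \<in> V" "X `` {x} = {} \<or> X `` {x} = W"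
        "y \<in> W" "X\<inverse> `` {y} = {} \<or> X\<inverse> `` {y} = V"
    by blast
  then show ?thesis
  proof cases
    case rows
    have "(\<Sum>y\<in>W. a) \<le> (\<Sum>y\<in>W. card (out_cut R (X\<inverse> `` {y})))"
      by (intro sum_mono cut(1) psubsetI) (use rows rowV in auto)
    then show ?thesis by (simp add: S_def mult.commute)
  next
    case cols
    have "(\<Sum>x\<in>V. b) \<le> (\<Sum>x\<in>V. card (out_cut T (X `` {x})))"
      by (intro sum_mono cut(2) psubsetI) (use cols colW in auto)
    then show ?thesis by (simp add: S_def mult.commute)
  next
    case uniform
    have cut1: "A \<noteq> {} \<Longrightarrow> A \<subset> V \<Longrightarrow> 1 \<le> card (out_cut R A)"
      "B \<noteq> {} \<Longrightarrow> B \<subset> W \<Longrightarrow> 1 \<le> card (out_cut T B)" for A B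
      by (rule order_trans[OF pos(1) cut(1)]; assumption) (rule order_trans[OF pos(2) cut(2)]; assumption)
    \<comment> \<open>a full row cannot avoid an empty column, nor a full column an empty row\<close>
    consider "X `` {x} = {}" "X\<inverse> `` {y} = {}" | "X `` {x} = W" "X\<inverse> `` {y} = V"
      using uniform by blast
    then show ?thesis
    proof cases
      case 1
      have "d + f \<le> S"
        unfolding S_def
        by (rule sparse_set_cut_bound[OF fin _ X(1) R T out cut1 uniform(1) 1(1) uniform(3) 1(2)])
          (use X in auto)
      then show ?thesis by blast
    next
      case 2
      \<comment> \<open>The full row and column of \<open>X\<close> become empty in
        \<open>Y\<close>. Against the reversed arcs each slice of \<open>Y\<close> has the same cut
        size as the slice of \<open>X\<close> it complements, so the total is still
        \<open>S\<close>.\<close>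
      define Y where "Y = V \<times> W - X"
      have Y: "Y \<subseteq> V \<times> W" "Y \<noteq> {}" using X(2) by (auto simp: Y_def)
      have rowY: "Y\<inverse> `` {y} = V - X\<inverse> `` {y}" if "y \<in> W" for y using that by (auto simp: Y_def)
      have colY: "Y `` {x} = W - X `` {x}" if "x \<in> V" for x using that by (auto simp: Y_def)
      have Rc: "R\<inverse> \<subseteq> V \<times> V" "\<And>x. (x, x) \<notin> R\<inverse>" and Tc: "T\<inverse> \<subseteq> W \<times> W" "\<And>y. (y, y) \<notin> T\<inverse>"
        using R T by auto
      have cutc: "A \<noteq> {} \<Longrightarrow> A \<subset> V \<Longrightarrow> 1 \<le> card (out_cut (R\<inverse>) A)"
        "B \<noteq> {} \<Longrightarrow> B \<subset> W \<Longrightarrow> 1 \<le> card (out_cut (T\<inverse>) B)" for A B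
      proof -
        assume "A \<noteq> {}" "A \<subset> V"
        then have "V - (V - A) = A" "V - A \<noteq> {}" "V - A \<subset> V" by auto
        then show "1 \<le> card (out_cut (R\<inverse>) A)"
          using cut1(1)[of "V - A"] card_out_cut_converse[OF R(1), of "V - A"] by simp
      next
        assume "B \<noteq> {}" "B \<subset> W"
        then have "W - (W - B) = B" "W - B \<noteq> {}" "W - B \<subset> W" by auto
        then show "1 \<le> card (out_cut (T\<inverse>) B)"
          using cut1(2)[of "W - B"] card_out_cut_converse[OF T(1), of "W - B"] by simp
      qed
      have "d' + f' \<le> (\<Sum>y\<in>W. card (out_cut (R\<inverse>) (Y\<inverse> `` {y}))) + (\<Sum>x\<in>V. card (out_cut (T\<inverse>) (Y `` {x})))"
        by (rule sparse_set_cut_bound[OF fin Y Rc Tc inn cutc uniform(1) _ uniform(3)])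
          (use 2 uniform in \<open>auto simp: rowY colY\<close>)
      also have "\<dots> = S"
        unfolding S_def
        by (intro arg_cong2[where f = "(+)"] sum.cong refl)
          (simp_all only: rowY colY card_out_cut_converse[OF R(1) rowV] card_out_cut_converse[OF T(1) colW])
      finally show ?thesis by blast
    qed
  qed
qed

section \<open>Degrees and arc-strong connectivity of one digraph through cuts\<close>

context pair_digraph
begin

lemma out_degree_eq_card_Image: "out_degree G v = card (parcs G `` {v})"
proof -
  have "out_arcs G v = Pair v ` (parcs G `` {v})" by (auto simp: out_arcs_def)
  then show ?thesis by (simp add: out_degree_def card_image inj_on_def)
qed

lemma in_degree_eq_card_Image: "in_degree G v = card ((parcs G)\<inverse> `` {v})"
proof -
  have "in_arcs G v = (\<lambda>u. (u, v)) ` ((parcs G)\<inverse> `` {v})" by (auto simp: in_arcs_def)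
  then show ?thesis by (simp add: in_degree_def card_image inj_on_def)
qed

lemma min_out_degree_le: "v \<in> pverts G \<Longrightarrow> min_out_degree G \<le> card (parcs G `` {v})"
  by (simp add: min_out_degree_def flip: out_degree_eq_card_Image)

lemma min_in_degree_le: "v \<in> pverts G \<Longrightarrow> min_in_degree G \<le> card ((parcs G)\<inverse> `` {v})"
  by (simp add: min_in_degree_def flip: in_degree_eq_card_Image)

lemma min_out_degree_attained:
  assumes "pverts G \<noteq> {}"
  obtains v where "v \<in> pverts G" "min_out_degree G = card (parcs G `` {v})"
proof -
  have "min_out_degree G \<in> out_degree G ` pverts G"
    unfolding min_out_degree_def by (rule Min_in) (use assms in auto)
  then show thesis using that by (auto simp: out_degree_eq_card_Image)
qed

lemma min_in_degree_attained:
  assumes "pverts G \<noteq> {}"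
  obtains v where "v \<in> pverts G" "min_in_degree G = card ((parcs G)\<inverse> `` {v})"
proof -
  have "min_in_degree G \<in> in_degree G ` pverts G"
    unfolding min_in_degree_def by (rule Min_in) (use assms in auto)
  then show thesis using that by (auto simp: in_degree_eq_card_Image)
qed

lemma parcs_subset: "parcs G \<subseteq> pverts G \<times> pverts G"
  using in_arcsD1 in_arcsD2 by auto

lemma no_loop_arc: "(x, x) \<notin> parcs G"
  using pair_no_loops by fastforce

text \<open>Once the arcs leaving \<open>X\<close> are deleted, a walk starting in \<open>X\<close>
  can never leave it, so the cut is a disconnecting set.\<close>

lemma arc_strong_connectivity_le_cut:
  assumes "2 \<le> card (pverts G)" "X \<noteq> {}" "X \<subset> pverts G"
  shows "arc_strong_connectivity G \<le> card (out_cut (parcs G) X)"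
proof -
  let ?D = "delete_arcs G (out_cut (parcs G) X)"
  obtain u v where uv: "u \<in> X" "v \<in> pverts G" "v \<notin> X" "u \<in> pverts G"
    using assms by auto
  have "\<not> strongly_connected ?D"
  proof
    assume "strongly_connected ?D"
    then have "u \<rightarrow>\<^sup>*\<^bsub>?D\<^esub> v"
      using uv by (auto simp: strongly_connected_def delete_arcs_def)
    then have "(u, v) \<in> (arcs_ends ?D)\<^sup>*"
      by (rule reachable_rtranclI)
    then have "v \<in> X"
      by (induction rule: rtrancl_induct)
        (use uv in \<open>auto simp: arcs_ends_def arc_to_ends_def delete_arcs_def out_cut_def\<close>)
    then show False using uv by simp
  qed
  then show ?thesis
    unfolding arc_strong_connectivity_def
    using disconnecting_arc_sets(1)[OF pair_digraph_axioms assms(1)]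
    by (intro Min_le) (auto simp: out_cut_def)
qed

lemma disconnecting_set_attained:
  assumes "2 \<le> card (pverts G)"
  obtains S where "S \<subseteq> parcs G" "\<not> strongly_connected (delete_arcs G S)"
    "card S = arc_strong_connectivity G"
  using Min_in[OF disconnecting_arc_sets[OF pair_digraph_axioms assms]]
  by (auto simp: arc_strong_connectivity_def)

text \<open>After deletion of a minimum disconnecting set, some \<open>u\<close> no longer reaches
  some \<open>v\<close>. The vertices still reachable from \<open>u\<close> form a set whose leaving
  arcs were all deleted, so its cut is no larger than the minimum.\<close>

lemma min_cut_attained:
  assumes "2 \<le> card (pverts G)"
  obtains X where "X \<noteq> {}" "X \<subset> pverts G"
    "card (out_cut (parcs G) X) = arc_strong_connectivity G"
proof -
  obtain S where S: "S \<subseteq> parcs G" "\<not> strongly_connected (delete_arcs G S)"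
    "card S = arc_strong_connectivity G"
    using disconnecting_set_attained[OF assms] .
  let ?D = "delete_arcs G S"
  \<comment> \<open>\<open>strongly_connected\<close> also demands a vertex; with that secured, its
    failure must come from an unreachable pair.\<close>
  have "pverts G \<noteq> {}" using assms by auto
  then obtain u v where uv: "u \<in> pverts G" "v \<in> pverts G" "\<not> u \<rightarrow>\<^sup>*\<^bsub>?D\<^esub> v"
    using S(2) by (auto simp: strongly_connected_def delete_arcs_def)
  interpret D: wf_digraph ?D
    by standard (auto simp: delete_arcs_def intro: in_arcsD1 in_arcsD2)
  define X where "X = {w \<in> pverts G. u \<rightarrow>\<^sup>*\<^bsub>?D\<^esub> w}"
  have "u \<rightarrow>\<^sup>*\<^bsub>?D\<^esub> u"
    by (rule D.reachable_refl) (use uv in \<open>simp add: delete_arcs_def\<close>)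
  then have X: "X \<noteq> {}" "X \<subset> pverts G" using uv by (auto simp: X_def)
  have "out_cut (parcs G) X \<subseteq> S"
  proof (rule subsetI, rule ccontr)
    fix e assume e: "e \<in> out_cut (parcs G) X" "e \<notin> S"
    obtain x y where xy: "e = (x, y)" by (cases e)
    \<comment> \<open>An arc leaving \<open>X\<close> that survived the deletion would make its head
      reachable from \<open>u\<close>, contradicting the choice of \<open>X\<close>.\<close>
    have "x \<rightarrow>\<^bsub>?D\<^esub> y"
      using e by (auto simp: xy out_cut_def delete_arcs_def arcs_ends_def arc_to_ends_def)
    moreover have "u \<rightarrow>\<^sup>*\<^bsub>?D\<^esub> x" using e by (simp add: xy out_cut_def X_def)
    ultimately have "u \<rightarrow>\<^sup>*\<^bsub>?D\<^esub> y" by (rule D.reachable_adj_trans[rotated])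
    then show False using e in_arcsD2 by (auto simp: xy out_cut_def X_def)
  qed
  then have "card (out_cut (parcs G) X) \<le> card S"
    using S(1) by (meson card_mono finite_subset pair_finite_arcs)
  then show thesis
    using that[OF X] arc_strong_connectivity_le_cut[OF assms X] S(3) by simp
qed

text \<open>Value 0 would make the empty set disconnecting. This supplies the one arc per nonempty
  proper slice in the lower bound.\<close>

lemma arc_strong_connectivity_pos:
  assumes "2 \<le> card (pverts G)" "strongly_connected G"
  shows "1 \<le> arc_strong_connectivity G"
proof (rule ccontr)
  assume "\<not> 1 \<le> arc_strong_connectivity G"
  moreover obtain S where S: "S \<subseteq> parcs G" "\<not> strongly_connected (delete_arcs G S)"
    "card S = arc_strong_connectivity G"
    using disconnecting_set_attained[OF assms(1)] .
  ultimately have "S = {}"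
    using finite_subset[OF S(1) pair_finite_arcs] by (metis card_0_eq less_one linorder_not_le)
  then show False using S(2) assms(2) by (simp add: delete_arcs_def)
qed

text \<open>The arcs out of \<open>v\<close> are the cut of its singleton; the arcs into
  \<open>v\<close> are the cut of the complement of that singleton.\<close>

lemma arc_strong_connectivity_le_degree:
  assumes "2 \<le> card (pverts G)" "v \<in> pverts G"
  shows "arc_strong_connectivity G \<le> card (parcs G `` {v})"
    and "arc_strong_connectivity G \<le> card ((parcs G)\<inverse> `` {v})"
proof -
  have ne: "pverts G \<noteq> {v}" using assms(1) by auto
  have "arc_strong_connectivity G \<le> card (out_cut (parcs G) {v})"
    by (rule arc_strong_connectivity_le_cut) (use assms ne in auto)
  then show "arc_strong_connectivity G \<le> card (parcs G `` {v})"
    by (simp add: card_out_cut_singleton no_loop_arc)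
  have "arc_strong_connectivity G \<le> card (out_cut (parcs G) (pverts G - {v}))"
    by (rule arc_strong_connectivity_le_cut) (use assms ne in auto)
  also have "\<dots> = card (out_cut ((parcs G)\<inverse>) {v})"
    using card_out_cut_converse[of "(parcs G)\<inverse>" "pverts G" "{v}"] parcs_subset assms(2) by auto
  finally show "arc_strong_connectivity G \<le> card ((parcs G)\<inverse> `` {v})"
    by (simp add: card_out_cut_singleton no_loop_arc)
qed

end

section \<open>Cuts and neighbourhoods in the Cartesian product\<close>

text \<open>A product arc changes exactly one coordinate, so it lies in one copy of \<open>G\<close>
  or of \<open>H\<close>, and it leaves \<open>X\<close> precisely when its projection leaves the
  corresponding slice.\<close>

lemma card_out_cut_cartesian_product:
  assumes "pair_digraph G" "pair_digraph H" "X \<subseteq> pverts G \<times> pverts H"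
  shows "card (out_cut (parcs (G \<box> H)) X) =
    (\<Sum>y\<in>pverts H. card (out_cut (parcs G) (X\<inverse> `` {y}))) +
    (\<Sum>x\<in>pverts G. card (out_cut (parcs H) (X `` {x})))"
proof -
  interpret G: pair_digraph G by fact
  interpret H: pair_digraph H by fact
  \<comment> \<open>\<open>P\<close> and \<open>Q\<close> hold the cut arcs of the factors, tagged
    by the fixed coordinate; \<open>p\<close> and \<open>q\<close> put them back into the
    product.\<close>
  define P where "P = Sigma (pverts H) (\<lambda>y. out_cut (parcs G) (X\<inverse> `` {y}))"
  define Q where "Q = Sigma (pverts G) (\<lambda>x. out_cut (parcs H) (X `` {x}))"
  define p :: "'b \<times> 'a \<times> 'a \<Rightarrow> ('a \<times> 'b) \<times> ('a \<times> 'b)"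
    where "p = (\<lambda>(y, u, v). ((u, y), (v, y)))"
  define q :: "'a \<times> 'b \<times> 'b \<Rightarrow> ('a \<times> 'b) \<times> ('a \<times> 'b)"
    where "q = (\<lambda>(x, u, v). ((x, u), (x, v)))"
  have finP: "finite P" and finQ: "finite Q"
    by (auto simp: P_def Q_def intro!: finite_SigmaI)
  have "out_cut (parcs (G \<box> H)) X = p ` P \<union> q ` Q"
  proof (rule set_eqI)
    fix e :: "('a \<times> 'b) \<times> ('a \<times> 'b)"
    obtain x y u v where e: "e = ((x, y), (u, v))" by (cases e) auto
    have "e \<in> p ` P \<longleftrightarrow> y = v \<and> y \<in> pverts H \<and> (x, u) \<in> parcs G \<and> (x, y) \<in> X \<and> (u, y) \<notin> X"
      by (force simp: e P_def p_def out_cut_def image_iff)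
    moreover have "e \<in> q ` Q \<longleftrightarrow> x = u \<and> x \<in> pverts G \<and> (y, v) \<in> parcs H \<and> (x, y) \<in> X \<and> (x, v) \<notin> X"
      by (force simp: e Q_def q_def out_cut_def image_iff)
    moreover have "e \<in> out_cut (parcs (G \<box> H)) X \<longleftrightarrow>
        ((x, u) \<in> parcs G \<and> y = v \<and> y \<in> pverts H \<or> x = u \<and> x \<in> pverts G \<and> (y, v) \<in> parcs H)
        \<and> (x, y) \<in> X \<and> (u, v) \<notin> X"
      using G.parcs_subset H.parcs_subset by (auto simp: e out_cut_def cartesian_product_def)
    ultimately show "e \<in> out_cut (parcs (G \<box> H)) X \<longleftrightarrow> e \<in> p ` P \<union> q ` Q" by auto
  qed
  \<comment> \<open>A common arc would change neither coordinate and would thus project to a loop of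
    \<open>G\<close>.\<close>
  moreover have "p ` P \<inter> q ` Q = {}"
    using G.no_loop_arc by (auto simp: out_cut_def P_def Q_def p_def q_def)
  moreover have "card (p ` P) = card P" "card (q ` Q) = card Q"
    by (auto intro!: card_image inj_onI simp: p_def q_def)
  ultimately have "card (out_cut (parcs (G \<box> H)) X) = card P + card Q"
    using finP finQ by (simp add: card_Un_disjoint)
  then show ?thesis by (simp add: P_def Q_def)
qed

lemma card_neighbours_cartesian_product:
  assumes "pair_digraph G" "pair_digraph H" "x \<in> pverts G" "y \<in> pverts H"
  shows "card (parcs (G \<box> H) `` {(x, y)}) = card (parcs G `` {x}) + card (parcs H `` {y})"
    and "card ((parcs (G \<box> H))\<inverse> `` {(x, y)}) = card ((parcs G)\<inverse> `` {x}) + card ((parcs H)\<inverse> `` {y})"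
proof -
  interpret G: pair_digraph G by fact
  interpret H: pair_digraph H by fact
  \<comment> \<open>The neighbourhood of \<open>(x, y)\<close> is a cross whose two arms could only
    share \<open>(x, y)\<close> itself; \<open>x\<close> lies outside \<open>A\<close> because
    \<open>G\<close> has no loops.\<close>
  have card: "card (A \<times> {y} \<union> {x} \<times> B) = card A + card B"
    if "x \<notin> A" "finite A" "finite B" for A B
    using that by (subst card_Un_disjoint) (auto simp: card_cartesian_product)
  have fin: "finite (parcs G `` {x})" "finite (parcs H `` {y})"
    "finite ((parcs G)\<inverse> `` {x})" "finite ((parcs H)\<inverse> `` {y})"
    by (auto intro!: finite_Image)
  have "parcs (G \<box> H) `` {(x, y)} = parcs G `` {x} \<times> {y} \<union> {x} \<times> parcs H `` {y}"
    using assms(3,4) G.parcs_subset H.parcs_subset by (auto simp: cartesian_product_def)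
  then show "card (parcs (G \<box> H) `` {(x, y)}) = card (parcs G `` {x}) + card (parcs H `` {y})"
    using card[OF _ fin(1,2)] G.no_loop_arc by simp
  have "(parcs (G \<box> H))\<inverse> `` {(x, y)} = (parcs G)\<inverse> `` {x} \<times> {y} \<union> {x} \<times> (parcs H)\<inverse> `` {y}"
    using assms(3,4) G.parcs_subset H.parcs_subset by (auto simp: cartesian_product_def)
  then show "card ((parcs (G \<box> H))\<inverse> `` {(x, y)}) = card ((parcs G)\<inverse> `` {x}) + card ((parcs H)\<inverse> `` {y})"
    using card[OF _ fin(3,4)] G.no_loop_arc by simp
qed

section \<open>The four upper bounds and the matching lower bound\<close>

theorem theorem3p1:
  fixes G :: "'a pair_pre_digraph" and H :: "'b pair_pre_digraph"
  assumes "pair_digraph G" and "pair_digraph H"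
    and "strongly_connected G" and "strongly_connected H"
    and "2 \<le> card (pverts G)" and "2 \<le> card (pverts H)"
  shows "arc_strong_connectivity (G \<box> H) =
    Min {arc_strong_connectivity G * card (pverts H),
         arc_strong_connectivity H * card (pverts G),
         min_out_degree G + min_out_degree H,
         min_in_degree G + min_in_degree H}"
proof -
  interpret G: pair_digraph G by fact
  interpret H: pair_digraph H by fact
  interpret P: pair_digraph "G \<box> H"
    using assms(1,2) by (rule pair_digraph_cartesian_product)
  let ?V = "pverts G" and ?W = "pverts H" and ?l = "arc_strong_connectivity (G \<box> H)"
  have verts: "pverts (G \<box> H) = ?V \<times> ?W" by (simp add: cartesian_product_def)
  have ne: "?V \<noteq> {}" "?W \<noteq> {}" using assms(5,6) by auto
  \<comment> \<open>At least two vertices in the product guarantee that \<open>?l\<close> is a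
    minimum over a nonempty set.\<close>
  have "2 * 1 \<le> card ?V * card ?W" by (rule mult_le_mono) (use assms(5,6) in auto)
  then have two: "2 \<le> card (pverts (G \<box> H))" by (simp add: verts card_cartesian_product)
  note cut_card = card_out_cut_cartesian_product[OF assms(1,2)]
  note nb = card_neighbours_cartesian_product[OF assms(1,2)]

  \<comment> \<open>A minimum cut \<open>A\<close> of \<open>G\<close> is thickened to
    \<open>A \<times> ?W\<close>: every row is \<open>A\<close>, and every column is empty or full
    and so emits nothing.\<close>
  have "?l \<le> arc_strong_connectivity G * card ?W"
  proof -
    obtain A where A: "A \<noteq> {}" "A \<subset> ?V" "card (out_cut (parcs G) A) = arc_strong_connectivity G"
      using G.min_cut_attained[OF assms(5)] .
    have "?l \<le> card (out_cut (parcs (G \<box> H)) (A \<times> ?W))"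
      by (rule P.arc_strong_connectivity_le_cut[OF two]) (use A ne in \<open>auto simp: verts\<close>)
    also have "\<dots> = (\<Sum>y\<in>?W. card (out_cut (parcs G) A)) + (\<Sum>x\<in>?V. 0)"
      unfolding cut_card[OF Sigma_mono[OF psubset_imp_subset[OF A(2)] order_refl]]
    proof (intro arg_cong2[where f = "(+)"] sum.cong refl)
      fix x
      have "(A \<times> ?W) `` {x} = (if x \<in> A then ?W else {})" by auto
      then show "card (out_cut (parcs H) ((A \<times> ?W) `` {x})) = 0"
        by (simp add: out_cut_full[OF H.parcs_subset])
    next
      fix y assume "y \<in> ?W"
      then have "(A \<times> ?W)\<inverse> `` {y} = A" by auto
      then show "card (out_cut (parcs G) ((A \<times> ?W)\<inverse> `` {y})) = card (out_cut (parcs G) A)" by simp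
    qed
    finally show ?thesis using A by (simp add: mult.commute)
  qed
  moreover have "?l \<le> arc_strong_connectivity H * card ?V"
  proof -
    obtain B where B: "B \<noteq> {}" "B \<subset> ?W" "card (out_cut (parcs H) B) = arc_strong_connectivity H"
      using H.min_cut_attained[OF assms(6)] .
    have "?l \<le> card (out_cut (parcs (G \<box> H)) (?V \<times> B))"
      by (rule P.arc_strong_connectivity_le_cut[OF two]) (use B ne in \<open>auto simp: verts\<close>)
    also have "\<dots> = (\<Sum>y\<in>?W. 0) + (\<Sum>x\<in>?V. card (out_cut (parcs H) B))"
      unfolding cut_card[OF Sigma_mono[OF order_refl psubset_imp_subset[OF B(2)]]]
    proof (intro arg_cong2[where f = "(+)"] sum.cong refl)
      fix y
      have "(?V \<times> B)\<inverse> `` {y} = (if y \<in> B then ?V else {})" by auto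
      then show "card (out_cut (parcs G) ((?V \<times> B)\<inverse> `` {y})) = 0"
        by (simp add: out_cut_full[OF G.parcs_subset])
    next
      fix x assume "x \<in> ?V"
      then have "(?V \<times> B) `` {x} = B" by auto
      then show "card (out_cut (parcs H) ((?V \<times> B) `` {x})) = card (out_cut (parcs H) B)" by simp
    qed
    finally show ?thesis using B by (simp add: mult.commute)
  qed
  \<comment> \<open>The degree bounds come from a single product vertex whose coordinates attain the
    two minimum degrees separately; its degree is their sum.\<close>
  moreover have "?l \<le> min_out_degree G + min_out_degree H"
  proof -
    obtain x where x: "x \<in> ?V" "min_out_degree G = card (parcs G `` {x})"
      using G.min_out_degree_attained[OF ne(1)] .
    obtain y where y: "y \<in> ?W" "min_out_degree H = card (parcs H `` {y})"
      using H.min_out_degree_attained[OF ne(2)] .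
    show ?thesis
      using P.arc_strong_connectivity_le_degree(1)[OF two, of "(x, y)"] nb(1) x y
      by (simp add: verts)
  qed
  moreover have "?l \<le> min_in_degree G + min_in_degree H"
  proof -
    obtain x where x: "x \<in> ?V" "min_in_degree G = card ((parcs G)\<inverse> `` {x})"
      using G.min_in_degree_attained[OF ne(1)] .
    obtain y where y: "y \<in> ?W" "min_in_degree H = card ((parcs H)\<inverse> `` {y})"
      using H.min_in_degree_attained[OF ne(2)] .
    show ?thesis
      using P.arc_strong_connectivity_le_degree(2)[OF two, of "(x, y)"] nb(2) x y
      by (simp add: verts)
  qed
  \<comment> \<open>The minimum of four numbers is at most \<open>?l\<close> exactly when one of
    them is; this disjunction is read off from a minimum cut \<open>X\<close> of the
    product.\<close>
  moreover have "arc_strong_connectivity G * card ?W \<le> ?l \<or>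
    arc_strong_connectivity H * card ?V \<le> ?l \<or>
    min_out_degree G + min_out_degree H \<le> ?l \<or> min_in_degree G + min_in_degree H \<le> ?l"
  proof -
    obtain X where X: "X \<noteq> {}" "X \<subset> ?V \<times> ?W" "card (out_cut (parcs (G \<box> H)) X) = ?l"
      using P.min_cut_attained[OF two] unfolding verts .
    show ?thesis
      unfolding X(3)[symmetric] cut_card[OF psubset_imp_subset[OF X(2)]]
      by (rule product_cut_lower_bound[OF G.pair_finite_verts H.pair_finite_verts X(1,2)
          G.parcs_subset G.no_loop_arc H.parcs_subset H.no_loop_arc
          G.min_out_degree_le H.min_out_degree_le G.min_in_degree_le H.min_in_degree_le
          G.arc_strong_connectivity_le_cut[OF assms(5)] H.arc_strong_connectivity_le_cut[OF assms(6)]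
          G.arc_strong_connectivity_pos[OF assms(5,3)] H.arc_strong_connectivity_pos[OF assms(6,4)]])
  qed
  ultimately show ?thesis by (auto simp: min_def)
qed

end
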